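(* For every integer $d \geq 2$ there exists a finite simplicial complex which is topologically $d$-representable but not $d$-collapsible.
   Context: Simplicial complexes are finite abstract simplicial complexes; the empty set counts as a face of dimension $-1$. Good covers: a $d$-cell is an open subset of $\mathbb{R}^d$ homeomorphic to an open $d$-ball. A good cover in $\mathbb{R}^d$ is a collection $\mathcal{G}$ of $d$-cells in $\mathbb{R}^d$ such that for every subcollection $\mathcal{G}' \subseteq \mathcal{G}$ the intersection of the sets in $\mathcal{G}'$ is either empty or a $d$-cell. Nerve: the nerve of a collection $\mathcal{F}$ of sets in $\mathbb{R}^d$ is the simplicial complex whose vertices are the sets in $\mathcal{F}$ and whose faces are the collections of vertices with nonempty intersection. Topologically $d$-representable: a finite simplicial complex is topologically $d$-representable if it is isomorphic to the nerve of a (finite) good cover in $\mathbb{R}^d$. $d$-collapsible: let $\mathbf{K}$ be a simplicial complex and let $\sigma$ be a face of $\mathbf{K}$ of dimension at most $d-1$ such that there is only one maximal (with respect to inclusion) face of $\mathbf{K}$ containing $\sigma$. Then the complex $\mathbf{K}' := \mathbf{K} \setminus \{\eta \in \mathbf{K} : \sigma \subseteq \eta\}$ is said to arise from $\mathbf{K}$ by an elementary $d$-collapse. The complex $\mathbf{K}$ is $d$-collapsible if it can be reduced to the empty complex by a (finite) sequence of elementary $d$-collapses. *)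

theory Defs
  imports "HOL-Analysis.Analysis"
begin

(* Prefixed names avoid the geometric simplicial_complex of HOL-Analysis. The vertex set of K is
   \<Union>K. Both {{}} (only the empty face) and {} (no face at all) are admitted; the latter is
   the empty complex at which collapsing ends. *)

definition abstract_complex :: "'a set set \<Rightarrow> bool" where
  "abstract_complex K \<longleftrightarrow>
     finite K \<and> (\<forall>\<sigma>\<in>K. finite \<sigma>) \<and> (\<forall>\<sigma>\<in>K. \<forall>\<tau>. \<tau> \<subseteq> \<sigma> \<longrightarrow> \<tau> \<in> K)"

definition face_dim :: "'a set \<Rightarrow> int" where
  "face_dim \<sigma> = int (card \<sigma>) - 1"

definition maximal_face :: "'a set set \<Rightarrow> 'a set \<Rightarrow> bool" where
  "maximal_face K \<tau> \<longleftrightarrow> \<tau> \<in> K \<and> (\<forall>\<rho>\<in>K. \<tau> \<subseteq> \<rho> \<longrightarrow> \<rho> = \<tau>)"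

definition complex_isomorphic :: "'a set set \<Rightarrow> 'b set set \<Rightarrow> bool" where
  "complex_isomorphic K L \<longleftrightarrow>
     (\<exists>f. bij_betw f (\<Union>K) (\<Union>L) \<and> (\<forall>\<sigma>. \<sigma> \<subseteq> \<Union>K \<longrightarrow> (\<sigma> \<in> K \<longleftrightarrow> f ` \<sigma> \<in> L)))"

definition elementary_collapse :: "nat \<Rightarrow> 'a set set \<Rightarrow> 'a set set \<Rightarrow> bool" where
  "elementary_collapse d K K' \<longleftrightarrow>
     (\<exists>\<sigma>\<in>K. face_dim \<sigma> \<le> int d - 1 \<and>
            (\<exists>!\<tau>. maximal_face K \<tau> \<and> \<sigma> \<subseteq> \<tau>) \<and>
            K' = K - {\<eta> \<in> K. \<sigma> \<subseteq> \<eta>})"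

definition collapsible :: "nat \<Rightarrow> 'a set set \<Rightarrow> bool" where
  "collapsible d K \<longleftrightarrow> (elementary_collapse d)\<^sup>*\<^sup>* K {}"

definition unit_open_ball :: "nat \<Rightarrow> (nat \<Rightarrow> real) set" where
  "unit_open_ball d = {x \<in> topspace (Euclidean_space d). (\<Sum>i<d. (x i)\<^sup>2) < 1}"

definition cell :: "nat \<Rightarrow> (nat \<Rightarrow> real) set \<Rightarrow> bool" where
  "cell d U \<longleftrightarrow>
     openin (Euclidean_space d) U \<and>
     subtopology (Euclidean_space d) U homeomorphic_space
       subtopology (Euclidean_space d) (unit_open_ball d)"

(* Intersections are taken inside R^d, so that the empty subcollection yields R^d rather than
   the whole type nat \<Rightarrow> real. *)

definition good_cover :: "nat \<Rightarrow> (nat \<Rightarrow> real) set set \<Rightarrow> bool" where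
  "good_cover d \<G> \<longleftrightarrow>
     (\<forall>U\<in>\<G>. cell d U) \<and>
     (\<forall>\<G>'. \<G>' \<subseteq> \<G> \<longrightarrow>
        topspace (Euclidean_space d) \<inter> \<Inter>\<G>' = {} \<or> cell d (topspace (Euclidean_space d) \<inter> \<Inter>\<G>'))"

definition nerve :: "'a set set \<Rightarrow> 'a set set set" where
  "nerve \<F> = {\<sigma>. \<sigma> \<subseteq> \<F> \<and> \<Inter>\<sigma> \<noteq> {}}"

definition topologically_representable :: "nat \<Rightarrow> 'a set set \<Rightarrow> bool" where
  "topologically_representable d K \<longleftrightarrow>
     (\<exists>\<G>. finite \<G> \<and> good_cover d \<G> \<and> complex_isomorphic K (nerve \<G>))"

end

theory Submission
  imports Defs "HOL-Complex_Analysis.Complex_Analysis"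
begin

text \<open>
  An elementary d-collapse needs a face with at most d vertices that lies in a unique maximal face.
  This is impossible as soon as every face with at most d vertices can be extended by two vertices
  that are not joined by an edge, so it suffices to find a good cover whose nerve has this property.

  In the plane, the faces of a trivalent tiling of the sphere would do: any two neighbours share an
  edge, whose two ends lie on disjoint third tiles. For a tiling of a disc the property fails only
  along the boundary, and the missing outer face cannot be added because it is not a cell. Instead
  the boundary is covered by three arc-shaped cells that overlap cyclically and turn into the
  interior at their ends, where they are far enough apart for all intersections to be cells.

  For larger d, take products of the planar sets with the remaining coordinate space and add the two
  open half-spaces of every further coordinate. This suspends the nerve, and a face that contains no
  half-space of some coordinate can be extended by either of the two; a face containing one for each
  coordinate has at most two vertices left in the planar part.
\<close>

section \<open>Intersections of rectangles and chains of rectangles\<close>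

text \<open>A connected open set in the plane is simply connected iff it is Borsukian, that is,
  every continuous map from it to the nonzero complex numbers is null-homotopic. Borsukian open sets
  can be glued along a connected overlap.\<close>

lemma simply_connected_open_Un:
  fixes S T :: "complex set"
  assumes "open S" "open T" "simply_connected S" "simply_connected T"
    and "connected (S \<inter> T)" "S \<inter> T \<noteq> {}"
  shows "simply_connected (S \<union> T)"
proof -
  have "Borsukian (S \<union> T)"
    using assms by (intro Borsukian_open_Un) (auto simp: simply_connected_eq_Borsukian open_Un openin_open_eq)
  moreover have "connected (S \<union> T)"
    using assms by (intro connected_Un) (auto simp: simply_connected_imp_connected)
  ultimately show ?thesis
    using assms by (simp add: simply_connected_eq_Borsukian open_Un)
qed

lemma simply_connected_chain:
  fixes C :: "nat \<Rightarrow> complex set"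
  assumes op: "\<And>k. k < m \<Longrightarrow> open (C k)" and cv: "\<And>k. k < m \<Longrightarrow> convex (C k)"
    and disj: "\<And>i k. \<lbrakk>k < m; Suc i < k\<rbrakk> \<Longrightarrow> C i \<inter> C k = {}"
    and gap: "\<And>i k. \<lbrakk>Suc k < m; i \<le> k; C i \<noteq> {}; C (Suc k) \<noteq> {}\<rbrakk> \<Longrightarrow> C k \<inter> C (Suc k) \<noteq> {}"
  shows "simply_connected (\<Union>k<m. C k)"
  using assms
proof (induction m)
  case 0
  then show ?case by simp
next
  case (Suc m)
  let ?V = "\<Union>k<m. C k"
  have V: "simply_connected ?V" "open ?V"
    using Suc by auto
  have Un: "(\<Union>k<Suc m. C k) = ?V \<union> C m"
    by (auto simp: lessThan_Suc)
  show ?case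
  proof (cases "?V = {} \<or> C m = {}")
    case True
    then show ?thesis
      unfolding Un using V Suc.prems(2)[of m] by (auto simp: convex_imp_simply_connected)
  next
    case False
    then obtain i where i: "i < m" "C i \<noteq> {}" "C m \<noteq> {}" by auto
    then obtain k where k: "m = Suc k" by (cases m) auto
    have "?V \<inter> C m = C k \<inter> C m"
    proof -
      have "C j \<inter> C m = {}" if "j < k" for j
        using Suc.prems(3)[of m j] that k by auto
      then show ?thesis
        unfolding k by (auto simp: less_Suc_eq) blast
    qed
    moreover have "C k \<inter> C m \<noteq> {}"
      using Suc.prems(4)[of k i] i k by auto
    moreover have "convex (C k \<inter> C m)"
      using Suc.prems(2) k by (intro convex_Int) auto
    ultimately show ?thesis
      unfolding Un using V Suc.prems(1,2)[of m]
      by (intro simply_connected_open_Un) (auto simp: convex_imp_simply_connected convex_connected)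
  qed
qed

section \<open>Helly property of axis-parallel rectangles\<close>

text \<open>Intervals may be empty or unbounded here, so the class is closed under all finite
  intersections, including the empty one.\<close>

definition is_rect :: "complex set \<Rightarrow> bool" where
  "is_rect R \<longleftrightarrow> (\<exists>I J. is_interval I \<and> is_interval J \<and> R = {z. Re z \<in> I \<and> Im z \<in> J})"

lemma is_rect_convex: "is_rect R \<Longrightarrow> convex R"
proof -
  assume "is_rect R"
  then obtain I J where IJ: "convex I" "convex J" "R = Re -` I \<inter> Im -` J"
    unfolding is_rect_def is_interval_convex_1 by auto
  show "convex R"
    unfolding IJ(3) using IJ(1,2)
    by (intro convex_Int convex_linear_vimage) (auto intro: bounded_linear.linear bounded_linear_Re bounded_linear_Im)
qed

lemma is_rect_Int: "is_rect R \<Longrightarrow> is_rect S \<Longrightarrow> is_rect (R \<inter> S)"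
proof -
  assume "is_rect R" "is_rect S"
  then obtain I J I' J' where "is_interval I" "is_interval J" "R = {z. Re z \<in> I \<and> Im z \<in> J}"
      "is_interval I'" "is_interval J'" "S = {z. Re z \<in> I' \<and> Im z \<in> J'}"
    unfolding is_rect_def by auto
  then show "is_rect (R \<inter> S)"
    unfolding is_rect_def by (intro exI[of _ "I \<inter> I'"] exI[of _ "J \<inter> J'"]) (auto simp: is_interval_Int)
qed

lemma is_rect_UNIV: "is_rect UNIV"
  unfolding is_rect_def by (intro exI[of _ UNIV]) auto

text \<open>Choose a point in each pairwise intersection. The median of the three lies between two
  points of the interval that it was not chosen from, hence in all three intervals.\<close>

lemma interval_Helly3:
  fixes I J K :: "real set"
  assumes "is_interval I" "is_interval J" "is_interval K"
    and "I \<inter> J \<noteq> {}" "J \<inter> K \<noteq> {}" "I \<inter> K \<noteq> {}"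
  shows "I \<inter> J \<inter> K \<noteq> {}"
proof -
  obtain x y z where xyz: "x \<in> I" "x \<in> J" "y \<in> J" "y \<in> K" "z \<in> I" "z \<in> K"
    using assms by blast
  have mid: "b \<in> L" if "is_interval L" "a \<in> L" "c \<in> L" "a \<le> b \<and> b \<le> c \<or> c \<le> b \<and> b \<le> a" for a b c :: real and L
    using that unfolding is_interval_1 by blast
  consider "y \<le> x \<and> x \<le> z \<or> z \<le> x \<and> x \<le> y" | "x \<le> y \<and> y \<le> z \<or> z \<le> y \<and> y \<le> x"
    | "x \<le> z \<and> z \<le> y \<or> y \<le> z \<and> z \<le> x"
    by linarith
  then show ?thesis
  proof cases
    case 1
    then show ?thesis using mid[OF assms(3), of y z x] xyz by blast
  next
    case 2
    then show ?thesis using mid[OF assms(1), of x z y] xyz by blast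
  next
    case 3
    then show ?thesis using mid[OF assms(2), of x y z] xyz by blast
  qed
qed

lemma rect_Helly3:
  assumes "is_rect R" "is_rect S" "is_rect T"
    and "R \<inter> S \<noteq> {}" "S \<inter> T \<noteq> {}" "R \<inter> T \<noteq> {}"
  shows "R \<inter> S \<inter> T \<noteq> {}"
proof -
  obtain I J where R: "is_interval I" "is_interval J" "R = {z. Re z \<in> I \<and> Im z \<in> J}"
    using assms(1) unfolding is_rect_def by auto
  obtain I' J' where S: "is_interval I'" "is_interval J'" "S = {z. Re z \<in> I' \<and> Im z \<in> J'}"
    using assms(2) unfolding is_rect_def by auto
  obtain I'' J'' where T: "is_interval I''" "is_interval J''" "T = {z. Re z \<in> I'' \<and> Im z \<in> J''}"
    using assms(3) unfolding is_rect_def by auto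
  have "I \<inter> I' \<inter> I'' \<noteq> {}" "J \<inter> J' \<inter> J'' \<noteq> {}"
    by (rule interval_Helly3; use assms(4-6) R S T in blast)+
  then obtain x y where "x \<in> I \<inter> I' \<inter> I''" "y \<in> J \<inter> J' \<inter> J''" by blast
  then have "Complex x y \<in> R \<inter> S \<inter> T"
    by (auto simp: R S T)
  then show ?thesis by blast
qed

lemma is_rect_Inter: "finite Q \<Longrightarrow> (\<And>W. W \<in> Q \<Longrightarrow> is_rect W) \<Longrightarrow> is_rect (\<Inter>Q)"
  by (induction rule: finite_induct) (auto simp: is_rect_UNIV is_rect_Int)

text \<open>In the induction, the new rectangle, the intersection of the earlier ones and
  \<open>C\<close> are three rectangles that meet pairwise.\<close>

lemma rect_Helly:
  assumes "finite Q" "\<And>W. W \<in> Q \<Longrightarrow> is_rect W" "\<Inter>Q \<noteq> {}"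
    and C: "is_rect C" "C \<noteq> {}" and "\<And>W. W \<in> Q \<Longrightarrow> W \<inter> C \<noteq> {}"
  shows "\<Inter>Q \<inter> C \<noteq> {}"
  using assms(1-3,6)
proof (induction rule: finite_induct)
  case empty
  then show ?case using C(2) by simp
next
  case (insert W Q)
  have W: "is_rect W" "W \<inter> C \<noteq> {}" "W \<inter> \<Inter>Q \<noteq> {}"
    using insert.prems(1)[OF insertI1] insert.prems(3)[OF insertI1] insert.prems(2) by simp_all
  have Q: "is_rect (\<Inter>Q)"
    by (rule is_rect_Inter[OF insert.hyps(1) insert.prems(1)[OF insertI2]])
  have "\<Inter>Q \<inter> C \<noteq> {}"
  proof (rule insert.IH)
    show "is_rect X" "X \<inter> C \<noteq> {}" if "X \<in> Q" for X
      using insert.prems(1,3)[of X] that by simp_all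
    show "\<Inter>Q \<noteq> {}"
      using W(3) by blast
  qed
  with W Q C(1) have "W \<inter> \<Inter>Q \<inter> C \<noteq> {}"
    by (intro rect_Helly3)
  then show ?case by simp
qed

section \<open>Cutting chains of rectangles by rectangles\<close>

text \<open>The last clause makes each single rectangle of \<open>T\<close> meet a run of the chain
  without gaps. It involves one rectangle at a time, so it can be checked by enumeration; the Helly
  property extends it to intersections of several.\<close>

definition rect_chain :: "complex set set \<Rightarrow> complex set list \<Rightarrow> bool" where
  "rect_chain T cs \<longleftrightarrow>
     (\<forall>C\<in>set cs. open C \<and> is_rect C) \<and>
     (\<forall>k<length cs. \<forall>i<k. cs ! i \<inter> cs ! k \<noteq> {} \<longleftrightarrow> Suc i = k) \<and>
     (\<forall>W\<in>T. \<forall>k<length cs. \<forall>j<k. \<forall>i<j. W \<inter> cs ! i \<noteq> {} \<longrightarrow> W \<inter> cs ! k \<noteq> {} \<longrightarrow> W \<inter> cs ! j \<noteq> {})"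

text \<open>Cut every link of the chain with \<open>\<Inter>T\<close>. The pieces are convex, and by
  the Helly property the nonempty ones again form a chain.\<close>

lemma simply_connected_rect_chain_Int:
  assumes T: "finite T" "\<And>W. W \<in> T \<Longrightarrow> open W \<and> is_rect W" and cs: "rect_chain T cs"
  shows "simply_connected (\<Inter>T \<inter> \<Union>(set cs))"
proof -
  have R: "open (\<Inter>T)" "is_rect (\<Inter>T)"
    using T by (auto intro: is_rect_Inter open_Inter)
  have nth: "open (cs ! k)" "is_rect (cs ! k)" if "k < length cs" for k
    using cs that by (auto simp: rect_chain_def)
  have disj: "cs ! i \<inter> cs ! k \<noteq> {} \<longleftrightarrow> Suc i = k" if "k < length cs" "i < k" for i k
    using cs that unfolding rect_chain_def by blast
  have between: "W \<inter> cs ! j \<noteq> {}"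
    if "W \<in> T" "k < length cs" "j < k" "i < j" "W \<inter> cs ! i \<noteq> {}" "W \<inter> cs ! k \<noteq> {}" for W i j k
    using cs that unfolding rect_chain_def by blast
  have "simply_connected (\<Union>k<length cs. \<Inter>T \<inter> cs ! k)"
  proof (rule simply_connected_chain)
    show "open (\<Inter>T \<inter> cs ! k)" "convex (\<Inter>T \<inter> cs ! k)" if "k < length cs" for k
      using R nth[OF that] by (auto intro: open_Int is_rect_convex is_rect_Int)
    show "(\<Inter>T \<inter> cs ! i) \<inter> (\<Inter>T \<inter> cs ! k) = {}" if "k < length cs" "Suc i < k" for i k
      using disj[OF that(1), of i] that by auto
    fix i k assume k: "Suc k < length cs" "i \<le> k" and i: "\<Inter>T \<inter> cs ! i \<noteq> {}" and k': "\<Inter>T \<inter> cs ! Suc k \<noteq> {}"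
    have adj: "cs ! k \<inter> cs ! Suc k \<noteq> {}"
      using disj[OF k(1), of k] by simp
    \<comment> \<open>Each \<open>W\<close> in \<open>T\<close> meets \<open>cs ! i\<close> and
      \<open>cs ! Suc k\<close>, hence \<open>cs ! k\<close> in between; the Helly property gives a
      point common to all of them.\<close>
    have Rk: "\<Inter>T \<inter> cs ! k \<noteq> {}"
    proof (cases "i = k")
      case False
      show ?thesis
      proof (rule rect_Helly[OF T(1)])
        show "W \<inter> cs ! k \<noteq> {}" if "W \<in> T" for W
        proof (rule between[OF that k(1)])
          show "W \<inter> cs ! i \<noteq> {}" "W \<inter> cs ! Suc k \<noteq> {}"
            using i k' \<open>W \<in> T\<close> by blast+
        qed (use False k(2) in simp_all)
        show "is_rect W" if "W \<in> T" for W
          using T(2)[OF that] by simp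
        show "\<Inter>T \<noteq> {}" "cs ! k \<noteq> {}"
          using i adj by blast+
        show "is_rect (cs ! k)"
          using nth k(1) by simp
      qed
    qed (use i in simp)
    have "\<Inter>T \<inter> cs ! k \<inter> cs ! Suc k \<noteq> {}"
      using R(2) nth k adj Rk k' by (intro rect_Helly3) auto
    then show "(\<Inter>T \<inter> cs ! k) \<inter> (\<Inter>T \<inter> cs ! Suc k) \<noteq> {}"
      by blast
  qed
  moreover have "set cs = (!) cs ` {..<length cs}"
    by (auto simp: set_conv_nth)
  then have "\<Inter>T \<inter> \<Union>(set cs) = (\<Union>k<length cs. \<Inter>T \<inter> cs ! k)"
    by (simp only:) blast
  ultimately show ?thesis
    by simp
qed

text \<open>Three cases: an intersection of rectangles alone is convex; with exactly one chain it is
  a cut chain; with at least two chains it is convex again, because one chosen chain meets each of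
  the others in a convex set.\<close>

lemma simply_connected_Inter_rects_chains:
  assumes T: "finite T" "\<And>W. W \<in> T \<Longrightarrow> open W \<and> is_rect W"
    and B: "finite B" "\<And>cs. cs \<in> B \<Longrightarrow> rect_chain T cs"
    and BB: "\<And>cs cs'. \<lbrakk>cs \<in> B; cs' \<in> B; cs \<noteq> cs'\<rbrakk> \<Longrightarrow> convex (\<Union>(set cs) \<inter> \<Union>(set cs'))"
    and Q: "Q \<subseteq> T \<union> (\<Union> \<circ> set) ` B"
  shows "open (\<Inter>Q) \<and> simply_connected (\<Inter>Q)"
proof
  have fin: "finite Q"
    using Q T(1) B(1) by (metis finite_UnI finite_imageI finite_subset)
  have opB: "open (\<Union>(set cs))" if "cs \<in> B" for cs
    using B(2)[OF that] by (auto simp: rect_chain_def)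
  then show "open (\<Inter>Q)"
    using Q T(2) fin by (intro open_Inter) auto
  define R where "R = Q \<inter> T"
  have R: "finite R" "\<And>W. W \<in> R \<Longrightarrow> open W \<and> is_rect W"
    using T fin by (auto simp: R_def)
  have cR: "convex (\<Inter>R)"
    using R by (auto intro: is_rect_convex is_rect_Inter)
  show "simply_connected (\<Inter>Q)"
  proof (cases "Q \<subseteq> T")
    case True
    then have "\<Inter>Q = \<Inter>R" by (simp add: R_def Int_absorb2)
    then show ?thesis using cR by (simp add: convex_imp_simply_connected)
  next
    case False
    then obtain cs where cs: "cs \<in> B" "\<Union>(set cs) \<in> Q" "\<Union>(set cs) \<notin> T"
      using Q by auto
    show ?thesis
    proof (cases "Q \<subseteq> insert (\<Union>(set cs)) T")
      case True
      then have "\<Inter>Q = \<Inter>R \<inter> \<Union>(set cs)"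
        using cs by (auto simp: R_def)
      moreover have "rect_chain R cs"
        using B(2)[OF cs(1)] unfolding rect_chain_def R_def by blast
      ultimately show ?thesis
        using simply_connected_rect_chain_Int[OF R] by simp
    next
      case False
      let ?Q' = "Q - insert (\<Union>(set cs)) T"
      have "convex (\<Union>(set cs) \<inter> X)" if "X \<in> ?Q'" for X
      proof -
        have "X \<in> Q" "X \<notin> T" "X \<noteq> \<Union>(set cs)" using that by auto
        then obtain cs' where cs': "cs' \<in> B" "X = \<Union>(set cs')"
          using subsetD[OF Q \<open>X \<in> Q\<close>] unfolding comp_def by blast
        with \<open>X \<noteq> \<Union>(set cs)\<close> have "cs \<noteq> cs'" by blast
        then show ?thesis
          unfolding cs'(2) by (rule BB[OF cs(1) cs'(1)])
      qed
      then have "convex (\<Inter>R \<inter> (\<Inter>X\<in>?Q'. \<Union>(set cs) \<inter> X))"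
        using cR by (intro convex_Int[OF cR] convex_INT) blast
      \<comment> \<open>The index set \<open>?Q'\<close> is nonempty in this case, so the chosen
        chain is not lost on the right-hand side.\<close>
      moreover have "\<Inter>Q = \<Inter>R \<inter> (\<Inter>X\<in>?Q'. \<Union>(set cs) \<inter> X)"
        using False cs(2) by (auto simp: R_def)
      ultimately show ?thesis
        by (simp add: convex_imp_simply_connected)
    qed
  qed
qed

section \<open>The planar family\<close>

text \<open>With integer end points, every incidence question about the planar family is decided by
  evaluation.\<close>

type_synonym box = "int \<times> int \<times> int \<times> int"

fun open_box :: "box \<Rightarrow> complex set" where
  "open_box (a, b, c, e) = {z. of_int a < Re z \<and> Re z < of_int b \<and> of_int c < Im z \<and> Im z < of_int e}"

fun box_Int :: "box \<Rightarrow> box \<Rightarrow> box" where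
  "box_Int (a, b, c, e) (a', b', c', e') = (max a a', min b b', max c c', min e e')"

fun nonempty_box :: "box \<Rightarrow> bool" where
  "nonempty_box (a, b, c, e) \<longleftrightarrow> a < b \<and> c < e"

definition region :: "box list \<Rightarrow> complex set" where
  "region bs = (\<Union>b\<in>set bs. open_box b)"

text \<open>Empty boxes are discarded so that disjointness of two regions becomes emptiness of a
  list.\<close>

definition common_boxes :: "box list \<Rightarrow> box list \<Rightarrow> box list" where
  "common_boxes bs cs = filter nonempty_box [box_Int b c. b \<leftarrow> bs, c \<leftarrow> cs]"

lemma open_box_Int: "open_box (box_Int b c) = open_box b \<inter> open_box c"
  by (cases b; cases c) auto

lemma open_box_eq_empty: "open_box b = {} \<longleftrightarrow> \<not> nonempty_box b"
proof (cases b)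
  case (fields p q r s)
  have "Complex ((of_int p + of_int q) / 2) ((of_int r + of_int s) / 2) \<in> open_box b" if "p < q" "r < s"
    using that by (simp add: fields)
  moreover have "open_box b = {}" if "\<not> (p < q \<and> r < s)"
    using that by (auto simp: fields dest: order.strict_trans)
  moreover have "nonempty_box b \<longleftrightarrow> p < q \<and> r < s"
    by (simp add: fields)
  ultimately show ?thesis
    by blast
qed

lemma open_open_box: "open (open_box b)"
  by (cases b) (auto intro!: open_Collect_conj open_Collect_less continuous_intros)

lemma is_rect_open_box: "is_rect (open_box b)"
proof (cases b)
  case (fields p q r s)
  show ?thesis
    unfolding is_rect_def fields
    by (intro exI[of _ "{of_int p<..<of_int q}"] exI[of _ "{of_int r<..<of_int s}"]) (auto simp: is_interval_oo)
qed

lemma region_common_boxes: "region (common_boxes bs cs) = region bs \<inter> region cs"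
proof -
  have mem: "q \<in> set (common_boxes bs cs) \<longleftrightarrow> nonempty_box q \<and> (\<exists>b\<in>set bs. \<exists>c\<in>set cs. q = box_Int b c)" for q
    by (auto simp: common_boxes_def)
  have "x \<in> region bs \<inter> region cs" if x: "x \<in> region (common_boxes bs cs)" for x
  proof -
    obtain q where q: "q \<in> set (common_boxes bs cs)" "x \<in> open_box q"
      using x unfolding region_def by (rule UN_E)
    then obtain b c where "b \<in> set bs" "c \<in> set cs" "q = box_Int b c"
      unfolding mem by (elim conjE bexE)
    with q(2) show ?thesis
      unfolding region_def by (auto simp: open_box_Int simp del: open_box.simps)
  qed
  moreover have "x \<in> region (common_boxes bs cs)" if x: "x \<in> region bs" "x \<in> region cs" for x
  proof -
    obtain b where b: "b \<in> set bs" "x \<in> open_box b"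
      using x(1) unfolding region_def by (rule UN_E)
    obtain c where c: "c \<in> set cs" "x \<in> open_box c"
      using x(2) unfolding region_def by (rule UN_E)
    have x: "x \<in> open_box (box_Int b c)"
      using b(2) c(2) by (simp add: open_box_Int)
    then have "open_box (box_Int b c) \<noteq> {}"
      by (rule contrapos_pn) simp
    then have "box_Int b c \<in> set (common_boxes bs cs)"
      using b(1) c(1) unfolding mem open_box_eq_empty not_not by blast
    then show ?thesis
      unfolding region_def using x by (rule UN_I)
  qed
  ultimately show ?thesis
    by (intro equalityI subsetI) simp_all
qed

lemma region_common_boxes_empty: "region bs \<inter> region cs = {} \<longleftrightarrow> common_boxes bs cs = []"
proof -
  have "nonempty_box b" if "b \<in> set (common_boxes bs cs)" for b
    using that by (simp add: common_boxes_def)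
  then have "region (common_boxes bs cs) = {} \<longleftrightarrow> common_boxes bs cs = []"
    unfolding region_def using open_box_eq_empty by (cases "common_boxes bs cs") auto
  then show ?thesis
    by (simp add: region_common_boxes)
qed

text \<open>
  The tiles are overlapping bricks that fill the rectangle from (0, 0) to (15, 5). The arcs cover its
  boundary: the top side carries all six inward turns, so the third arc also runs around the other
  three sides. A computer search reduced an initial drawing of this kind to the present coordinates.
\<close>

definition tiles :: "box list" where
  "tiles = [(2, 5, 3, 5), (5, 8, 3, 5), (8, 11, 3, 5), (3, 7, 2, 4), (6, 8, 2, 4), (9, 12, 1, 4),
    (10, 14, 1, 3), (7, 9, 2, 5), (8, 10, 2, 4), (11, 13, 2, 5), (0, 2, 0, 5), (13, 15, 1, 5),
    (1, 4, 2, 4), (4, 10, 1, 3), (0, 6, 0, 3), (2, 15, 0, 2)]"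

definition arcs :: "box list list" where
  "arcs = [
    [(1, 3, 3, 5), (0, 10, 4, 5), (8, 10, 2, 5)],
    [(6, 8, 2, 5), (6, 14, 4, 5), (12, 14, 2, 5)],
    [(10, 12, 3, 5), (10, 15, 4, 5), (14, 15, 0, 5), (0, 15, 0, 1), (0, 1, 0, 5), (0, 6, 4, 5),
     (4, 6, 3, 5)]]"

definition members :: "box list list" where
  "members = arcs @ map (\<lambda>t. [t]) tiles"

definition has_disjoint_neighbours :: "box list \<Rightarrow> bool" where
  "has_disjoint_neighbours bs \<longleftrightarrow>
     (let ns = filter (\<lambda>cs. common_boxes bs cs \<noteq> []) members
      in list_ex (\<lambda>x. list_ex (\<lambda>y. common_boxes x y = []) ns) ns)"

section \<open>Finite checks on the planar family\<close>

text \<open>The pairs include \<open>u = v\<close>, so faces with one vertex are treated together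
  with edges of the nerve.\<close>

lemma members_linked:
  "list_all (\<lambda>u. list_all (\<lambda>v. let w = common_boxes u v in w = [] \<or> has_disjoint_neighbours w) members) members"
  by code_simp

lemma arcs_are_chains:
  "\<forall>bs\<in>set arcs. \<forall>k\<in>{..<length bs}. \<forall>i\<in>{..<k}. nonempty_box (box_Int (bs ! i) (bs ! k)) \<longleftrightarrow> Suc i = k"
  by code_simp

lemma tiles_meet_arcs_contiguously:
  "\<forall>bs\<in>set arcs. \<forall>t\<in>set tiles. \<forall>k\<in>{..<length bs}. \<forall>j\<in>{..<k}. \<forall>i\<in>{..<j}.
     nonempty_box (box_Int t (bs ! i)) \<longrightarrow> nonempty_box (box_Int t (bs ! k)) \<longrightarrow>
     nonempty_box (box_Int t (bs ! j))"
  by (simp add: arcs_def tiles_def lessThan_nat_numeral lessThan_Suc)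

text \<open>The equation \<open>box_Int p q = q\<close> expresses that \<open>q\<close> lies in
  \<open>p\<close>: one box absorbs the whole overlap of two arcs. This works because the inward
  turns at an overlap are disjoint from each other, so only the strips along the top side contribute
  beyond what they already cover.\<close>

lemma arcs_meet_in_boxes:
  "\<forall>bs\<in>set arcs. \<forall>cs\<in>set arcs. bs \<noteq> cs \<longrightarrow>
     (\<exists>p\<in>set (common_boxes bs cs). \<forall>q\<in>set (common_boxes bs cs). box_Int p q = q)"
  by code_simp

lemma members_nonempty: "\<forall>bs\<in>set members. common_boxes bs bs \<noteq> []"
  by code_simp

lemma rect_chain_arcs:
  assumes "bs \<in> set arcs"
  shows "rect_chain (open_box ` set tiles) (map open_box bs)"
proof -
  have meet: "open_box b \<inter> open_box c \<noteq> {} \<longleftrightarrow> nonempty_box (box_Int b c)" for b c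
    using open_box_eq_empty[of "box_Int b c"] by (simp add: open_box_Int)
  have "map open_box bs ! i \<inter> map open_box bs ! k \<noteq> {} \<longleftrightarrow> Suc i = k" if "k < length bs" "i < k" for i k
    using arcs_are_chains assms that by (simp add: meet)
  moreover have "open_box t \<inter> map open_box bs ! j \<noteq> {}"
    if "t \<in> set tiles" "k < length bs" "j < k" "i < j"
      "open_box t \<inter> map open_box bs ! i \<noteq> {}" "open_box t \<inter> map open_box bs ! k \<noteq> {}" for t i j k
  proof -
    have "nonempty_box (box_Int t (bs ! j))"
      using that(5,6) tiles_meet_arcs_contiguously[THEN bspec, OF assms, THEN bspec, OF that(1),
        THEN bspec, of k, THEN bspec, of j, THEN bspec, of i] that(2-4)
      by (simp add: meet)
    then show ?thesis
      using that(2-4) by (simp add: meet)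
  qed
  ultimately show ?thesis
    unfolding rect_chain_def by (simp add: open_open_box is_rect_open_box)
qed

lemma convex_arcs_Int:
  assumes "bs \<in> set arcs" "cs \<in> set arcs" "bs \<noteq> cs"
  shows "convex (region bs \<inter> region cs)"
proof -
  obtain p where p: "p \<in> set (common_boxes bs cs)" "\<And>q. q \<in> set (common_boxes bs cs) \<Longrightarrow> box_Int p q = q"
    using arcs_meet_in_boxes assms by blast
  then have "open_box q \<subseteq> open_box p" if "q \<in> set (common_boxes bs cs)" for q
    using that by (metis open_box_Int inf_le1)
  then have "region (common_boxes bs cs) = open_box p"
    using p(1) unfolding region_def by blast
  then show ?thesis
    using is_rect_convex[OF is_rect_open_box, of p] by (simp add: region_common_boxes)
qed

section \<open>Transfer from box lists to sets in the plane\<close>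

definition planar_family :: "complex set set" where
  "planar_family = region ` set members"

lemma planar_family_Inter:
  assumes "Q \<subseteq> planar_family"
  shows "open (\<Inter>Q) \<and> simply_connected (\<Inter>Q)"
proof (rule simply_connected_Inter_rects_chains)
  let ?T = "open_box ` set tiles" and ?B = "map open_box ` set arcs"
  show "finite ?T" "finite ?B" by auto
  show "open W \<and> is_rect W" if "W \<in> ?T" for W
    using that open_open_box is_rect_open_box by blast
  show "rect_chain ?T cs" if "cs \<in> ?B" for cs
    using that rect_chain_arcs by blast
  have region: "\<Union>(set (map open_box bs)) = region bs" for bs
    by (simp add: region_def)
  show "convex (\<Union>(set cs) \<inter> \<Union>(set cs'))" if cs: "cs \<in> ?B" "cs' \<in> ?B" "cs \<noteq> cs'" for cs cs'
  proof -
    obtain bs bs' where bs: "bs \<in> set arcs" "bs' \<in> set arcs" "cs = map open_box bs" "cs' = map open_box bs'"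
      using cs by blast
    with cs(3) have "bs \<noteq> bs'" by blast
    then show ?thesis
      unfolding bs(3,4) region by (rule convex_arcs_Int[OF bs(1,2)])
  qed
  have "planar_family = ?T \<union> (\<Union> \<circ> set) ` ?B"
    by (simp add: planar_family_def members_def region_def image_image image_Un Un_commute)
  with assms show "Q \<subseteq> ?T \<union> (\<Union> \<circ> set) ` ?B" by simp
qed

lemma planar_family_link:
  assumes "U \<in> planar_family" "V \<in> planar_family" "U \<inter> V \<noteq> {}"
  shows "\<exists>X\<in>planar_family. \<exists>Y\<in>planar_family. U \<inter> V \<inter> X \<noteq> {} \<and> U \<inter> V \<inter> Y \<noteq> {} \<and> X \<inter> Y = {}"
proof -
  obtain u v where uv: "u \<in> set members" "v \<in> set members" "U = region u" "V = region v"
    using assms(1,2) unfolding planar_family_def by blast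
  define w where "w = common_boxes u v"
  have "w \<noteq> []"
    using assms(3) uv by (simp add: w_def region_common_boxes_empty)
  then have "has_disjoint_neighbours w"
    using members_linked uv(1,2) unfolding list_all_iff Let_def w_def by blast
  then obtain x y where xy: "x \<in> set members" "y \<in> set members"
      "common_boxes w x \<noteq> []" "common_boxes w y \<noteq> []" "common_boxes x y = []"
    unfolding has_disjoint_neighbours_def Let_def list_ex_iff by auto
  have "region w = U \<inter> V"
    by (simp add: w_def region_common_boxes uv)
  with xy(3-5) have "U \<inter> V \<inter> region x \<noteq> {}" "U \<inter> V \<inter> region y \<noteq> {}" "region x \<inter> region y = {}"
    by (simp_all flip: region_common_boxes_empty)
  then show ?thesis
    unfolding planar_family_def using xy(1,2) by blast
qed

lemma planar_family_nonempty: "finite planar_family" "planar_family \<noteq> {}" "{} \<notin> planar_family"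
proof -
  show "finite planar_family" "planar_family \<noteq> {}"
    by (simp_all add: planar_family_def members_def arcs_def)
  have "region bs \<noteq> {}" if "bs \<in> set members" for bs
    using members_nonempty that region_common_boxes_empty[of bs bs] by auto
  then show "{} \<notin> planar_family"
    unfolding planar_family_def by blast
qed

section \<open>Cells in Euclidean space\<close>

text \<open>This passes from abstract topologies to the topology of the function type, where
  \<open>continuous_on\<close> and \<open>homeomorphic\<close> are available.\<close>

lemma Euclidean_space_eq_top_of_set: "Euclidean_space d = top_of_set {x. \<forall>i\<ge>d. x i = 0}"
  by (simp add: Euclidean_space_def euclidean_product_topology)

lemma homeomorphic_imp_homeomorphic_space:
  assumes "S homeomorphic T"
  shows "top_of_set S homeomorphic_space top_of_set T"
proof -
  obtain f g where "homeomorphism S T f g"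
    using assms unfolding homeomorphic_def by blast
  then have "homeomorphic_maps (top_of_set S) (top_of_set T) f g"
    by (force simp: Pi_iff homeomorphic_maps_def homeomorphism_def)
  then show ?thesis
    unfolding homeomorphic_space_def by blast
qed

lemma continuous_on_coordinate [continuous_intros]: "continuous_on S (\<lambda>x::nat \<Rightarrow> real. x i)"
  by (rule continuous_on_subset[OF continuous_on_product_coordinates]) simp

lemma homeomorphic_unit_open_ball: "topspace (Euclidean_space d) homeomorphic unit_open_ball d"
proof -
  define s where "s = (\<lambda>x::nat \<Rightarrow> real. \<Sum>i<d. (x i)\<^sup>2)"
  have s0: "s x \<ge> 0" for x
    by (simp add: s_def sum_nonneg)
  have scale: "s (\<lambda>i. x i / c) = s x / c\<^sup>2" for x c
    by (simp add: s_def power_divide sum_divide_distrib)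
  have cs: "continuous_on S s" for S
    unfolding s_def by (intro continuous_intros)
  \<comment> \<open>Radial rescaling: \<open>f\<close> turns the squared norm \<open>s\<close> into
    \<open>s / (1 + s)\<close>, which is below 1, and \<open>g\<close> turns it into
    \<open>s / (1 - s)\<close>; these two real functions are mutually inverse.\<close>
  define f where "f = (\<lambda>(x::nat \<Rightarrow> real) i. x i / sqrt (1 + s x))"
  define g where "g = (\<lambda>(x::nat \<Rightarrow> real) i. x i / sqrt (1 - s x))"
  have sf: "s (f x) = s x / (1 + s x)" for x
    using s0[of x] by (simp add: f_def scale)
  have sg: "s (g x) = s x / (1 - s x)" if "s x < 1" for x
    using that by (simp add: g_def scale)
  have gf: "g (f x) = x" for x
  proof -
    have "1 - s x / (1 + s x) = 1 / (1 + s x)"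
      using s0[of x] by (simp add: field_simps)
    then show ?thesis
      unfolding g_def sf using s0[of x] by (auto simp: f_def real_sqrt_divide)
  qed
  have "homeomorphism (topspace (Euclidean_space d)) (unit_open_ball d) f g"
    unfolding homeomorphism_def
  proof (intro conjI ballI equalityI subsetI)
    fix x assume x: "x \<in> topspace (Euclidean_space d)"
    show "g (f x) = x"
      by (rule gf)
  next
    fix y assume y: "y \<in> unit_open_ball d"
    then have y1: "s y < 1"
      by (simp add: unit_open_ball_def s_def)
    have "1 + s y / (1 - s y) = 1 / (1 - s y)"
      using y1 by (simp add: field_simps)
    then show fg: "f (g y) = y"
      unfolding f_def sg[OF y1] using y1 by (auto simp: g_def real_sqrt_divide)
    have "g y \<in> topspace (Euclidean_space d)"
      using y by (simp add: unit_open_ball_def topspace_Euclidean_space g_def)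
    with fg show "y \<in> f ` topspace (Euclidean_space d)"
      by (metis imageI)
  next
    have "s (f x) < 1" for x
      unfolding sf using s0[of x] by simp
    then have fb: "f x \<in> unit_open_ball d" if "x \<in> topspace (Euclidean_space d)" for x
      using that by (simp add: unit_open_ball_def topspace_Euclidean_space f_def s_def)
    then show "y \<in> unit_open_ball d" if "y \<in> f ` topspace (Euclidean_space d)" for y
      using that by auto
    show "y \<in> topspace (Euclidean_space d)" if "y \<in> g ` unit_open_ball d" for y
      using that by (auto simp: unit_open_ball_def topspace_Euclidean_space g_def)
    fix x assume x: "x \<in> topspace (Euclidean_space d)"
    show "x \<in> g ` unit_open_ball d"
      using imageI[OF fb[OF x], of g] by (simp add: gf)
  next
    have "1 + s x \<noteq> 0" for x
      using s0[of x] by linarith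
    then show "continuous_on (topspace (Euclidean_space d)) f"
      unfolding f_def
      by (intro continuous_on_coordinatewise_then_product continuous_intros cs
          continuous_on_coordinate) auto
    have "1 - s x \<noteq> 0" if "x \<in> unit_open_ball d" for x
      using that by (simp add: unit_open_ball_def s_def)
    then show "continuous_on (unit_open_ball d) g"
      unfolding g_def
      by (intro continuous_on_coordinatewise_then_product continuous_intros cs
          continuous_on_coordinate) auto
  qed
  then show ?thesis
    unfolding homeomorphic_def by blast
qed

section \<open>Prisms over planar sets\<close>

text \<open>The product of a planar set, in coordinates 0 and 1, with one set of reals for each
  further coordinate. All intersections of members of the suspended cover have this shape.\<close>

definition prism :: "nat \<Rightarrow> complex set \<Rightarrow> (nat \<Rightarrow> real set) \<Rightarrow> (nat \<Rightarrow> real) set" where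
  "prism d U I = {x. (\<forall>i\<ge>d. x i = 0) \<and> Complex (x 0) (x 1) \<in> U \<and> (\<forall>j\<in>{2..<d}. x j \<in> I j)}"

lemma continuous_on_Complex_coordinates:
  "continuous_on S (\<lambda>x::nat \<Rightarrow> real. Complex (x i) (x j))"
  unfolding Complex_eq by (intro continuous_intros)

text \<open>The homeomorphisms of the factors are applied side by side: one on the first two
  coordinates, read as a complex number, and one on each later coordinate.\<close>

lemma homeomorphic_prism:
  assumes "d \<ge> 2" and U: "U homeomorphic (UNIV :: complex set)"
    and I: "\<And>j. j \<in> {2..<d} \<Longrightarrow> I j homeomorphic (UNIV :: real set)"
  shows "prism d U I homeomorphic topspace (Euclidean_space d)"
proof -
  obtain h h' where h: "homeomorphism U (UNIV :: complex set) h h'"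
    using U homeomorphic_def by blast
  obtain p q where pq: "\<And>j. j \<in> {2..<d} \<Longrightarrow> homeomorphism (I j) (UNIV :: real set) (p j) (q j)"
    using I unfolding homeomorphic_def by metis
  define f where "f = (\<lambda>(x::nat \<Rightarrow> real) i.
    if i = 0 then Re (h (Complex (x 0) (x 1))) else if i = 1 then Im (h (Complex (x 0) (x 1)))
    else if i < d then p i (x i) else 0)"
  define g where "g = (\<lambda>(x::nat \<Rightarrow> real) i.
    if i = 0 then Re (h' (Complex (x 0) (x 1))) else if i = 1 then Im (h' (Complex (x 0) (x 1)))
    else if i < d then q i (x i) else 0)"
  have P: "Complex (x 0) (x 1) \<in> U" "\<And>j. j \<in> {2..<d} \<Longrightarrow> x j \<in> I j" "\<And>i. i \<ge> d \<Longrightarrow> x i = 0"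
    if "x \<in> prism d U I" for x
    using that by (auto simp: prism_def)
  have f_in: "f x \<in> topspace (Euclidean_space d)" for x
    using \<open>d \<ge> 2\<close> by (auto simp: f_def topspace_Euclidean_space)
  have g_in: "g x \<in> prism d U I" for x
  proof -
    have "h' z \<in> U" for z
      using h unfolding homeomorphism_def by blast
    moreover have "q j t \<in> I j" if "j \<in> {2..<d}" for j t
      using pq[OF that] unfolding homeomorphism_def by blast
    ultimately show ?thesis
      using \<open>d \<ge> 2\<close> by (auto simp: prism_def g_def)
  qed
  have gf: "g (f x) = x" if "x \<in> prism d U I" for x
  proof
    fix i
    have "h' (h (Complex (x 0) (x 1))) = Complex (x 0) (x 1)"
      using h P(1)[OF that] by (simp add: homeomorphism_def)
    moreover have "q i (p i (x i)) = x i" if "i \<in> {2..<d}"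
      using pq[OF that] P(2)[OF \<open>x \<in> prism d U I\<close> that] by (simp add: homeomorphism_def)
    ultimately show "g (f x) i = x i"
      using P(3)[OF that, of i] by (auto simp: f_def g_def)
  qed
  have fg: "f (g y) = y" if "y \<in> topspace (Euclidean_space d)" for y
  proof
    fix i
    have "h (h' (Complex (y 0) (y 1))) = Complex (y 0) (y 1)"
      using h by (simp add: homeomorphism_def)
    moreover have "p i (q i (y i)) = y i" if "i \<in> {2..<d}"
      using pq[OF that] by (simp add: homeomorphism_def)
    ultimately show "f (g y) i = y i"
      using that by (auto simp: f_def g_def topspace_Euclidean_space)
  qed
  have cf: "continuous_on (prism d U I) f"
  proof (rule continuous_on_coordinatewise_then_product)
    fix i
    have H: "continuous_on (prism d U I) (\<lambda>x. h (Complex (x 0) (x 1)))"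
      by (rule continuous_on_compose2[OF _ continuous_on_Complex_coordinates, of U])
        (use h P in \<open>auto simp: homeomorphism_def\<close>)
    moreover have "continuous_on (prism d U I) (\<lambda>x. p i (x i))" if "i \<in> {2..<d}"
      by (rule continuous_on_compose2[OF _ continuous_on_coordinate, of "I i"])
        (use pq[OF that] P that in \<open>auto simp: homeomorphism_def\<close>)
    ultimately show "continuous_on (prism d U I) (\<lambda>x. f x i)"
      by (cases "i = 0"; cases "i = 1"; cases "i < d") (auto simp: f_def intro!: continuous_intros)
  qed
  have cg: "continuous_on (topspace (Euclidean_space d)) g"
  proof (rule continuous_on_coordinatewise_then_product)
    fix i
    have H: "continuous_on (topspace (Euclidean_space d)) (\<lambda>x. h' (Complex (x 0) (x 1)))"
      by (rule continuous_on_compose2[OF _ continuous_on_Complex_coordinates, of UNIV])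
        (use h in \<open>auto simp: homeomorphism_def\<close>)
    moreover have "continuous_on (topspace (Euclidean_space d)) (\<lambda>x. q i (x i))" if "i \<in> {2..<d}"
      by (rule continuous_on_compose2[OF _ continuous_on_coordinate, of UNIV])
        (use pq[OF that] in \<open>auto simp: homeomorphism_def\<close>)
    ultimately show "continuous_on (topspace (Euclidean_space d)) (\<lambda>x. g x i)"
      by (cases "i = 0"; cases "i = 1"; cases "i < d") (auto simp: g_def intro!: continuous_intros)
  qed
  show ?thesis
    unfolding homeomorphic_minimal
    by (intro exI[of _ f] exI[of _ g] conjI ballI f_in g_in gf fg cf cg)
qed

lemma homeomorphic_halfline_real:
  "({0<..} :: real set) homeomorphic (UNIV :: real set)" "({..<0} :: real set) homeomorphic (UNIV :: real set)"
proof -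
  show "({0<..} :: real set) homeomorphic (UNIV :: real set)"
    unfolding homeomorphic_minimal
    by (rule exI[of _ ln], rule exI[of _ exp]) (auto intro!: continuous_intros)
  show "({..<0} :: real set) homeomorphic (UNIV :: real set)"
    unfolding homeomorphic_minimal
    by (rule exI[of _ "\<lambda>x. ln (- x)"], rule exI[of _ "\<lambda>x. - exp x"]) (auto intro!: continuous_intros)
qed

text \<open>By the Riemann mapping theorem in its topological form, both \<open>U\<close> and the
  whole plane are homeomorphic to the open unit disc.\<close>

lemma open_simply_connected_homeomorphic_plane:
  fixes U :: "complex set"
  assumes "open U" "simply_connected U" "U \<noteq> {}"
  shows "U homeomorphic (UNIV :: complex set)"
proof -
  have "V homeomorphic ball (0::complex) 1" if "open V" "simply_connected V" "V \<noteq> {}" for V :: "complex set"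
    using simply_connected_eq_homeomorphic_to_disc[OF that(1)] that by auto
  from this[OF assms] this[of UNIV] show ?thesis
    by (auto simp: convex_imp_simply_connected intro: homeomorphic_trans homeomorphic_sym[THEN iffD1])
qed

text \<open>The four values of \<open>I j\<close> are the possible intersections of half-lines. The
  value \<open>{}\<close> comes from using both half-lines of a coordinate and is excluded by the
  prism being nonempty.\<close>

lemma cell_prism:
  assumes "d \<ge> 2" "open U" "simply_connected U" "prism d U I \<noteq> {}"
    and I: "\<And>j. j \<in> {2..<d} \<Longrightarrow> I j \<in> {UNIV, {}, {..<0}, {0<..}}"
  shows "cell d (prism d U I)"
proof -
  have "I j \<noteq> {}" if "j \<in> {2..<d}" for j
    using assms(4) that by (auto simp: prism_def)
  then have Ij: "I j homeomorphic (UNIV :: real set) \<and> open (I j)" if "j \<in> {2..<d}" for j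
    using I[OF that] that by (auto simp: homeomorphic_halfline_real homeomorphic_refl)
  have "U \<noteq> {}"
    using assms(4) by (auto simp: prism_def)
  then have "prism d U I homeomorphic topspace (Euclidean_space d)"
    using assms Ij by (intro homeomorphic_prism open_simply_connected_homeomorphic_plane) auto
  then have "prism d U I homeomorphic unit_open_ball d"
    using homeomorphic_unit_open_ball homeomorphic_trans by blast
  then have "top_of_set (prism d U I) homeomorphic_space top_of_set (unit_open_ball d)"
    by (rule homeomorphic_imp_homeomorphic_space)
  moreover have sub: "prism d U I \<subseteq> {x. \<forall>i\<ge>d. x i = 0}" "unit_open_ball d \<subseteq> {x. \<forall>i\<ge>d. x i = 0}"
    by (auto simp: prism_def unit_open_ball_def topspace_Euclidean_space)
  moreover have "openin (Euclidean_space d) (prism d U I)"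
  proof -
    have "open ((\<lambda>x::nat \<Rightarrow> real. Complex (x 0) (x 1)) -` U)"
      using assms(2) continuous_on_Complex_coordinates by (rule open_vimage)
    moreover have "open (\<Inter>j\<in>{2..<d}. (\<lambda>x::nat \<Rightarrow> real. x j) -` I j)"
      using Ij by (intro open_INT ballI open_vimage continuous_on_coordinate) auto
    ultimately have "open ((\<lambda>x::nat \<Rightarrow> real. Complex (x 0) (x 1)) -` U \<inter>
        (\<Inter>j\<in>{2..<d}. (\<lambda>x::nat \<Rightarrow> real. x j) -` I j))" (is "open ?O")
      by (rule open_Int)
    moreover have "prism d U I = {x. \<forall>i\<ge>d. x i = 0} \<inter> ?O"
      by (auto simp: prism_def)
    ultimately show ?thesis
      unfolding Euclidean_space_eq_top_of_set openin_open by blast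
  qed
  ultimately show ?thesis
    unfolding cell_def Euclidean_space_eq_top_of_set
    by (simp add: subtopology_subtopology Int_absorb1)
qed

section \<open>Suspension and non-collapsibility\<close>

text \<open>Already the first collapse is impossible. Maximal faces above
  \<open>insert x \<sigma>\<close> and \<open>insert y \<sigma>\<close> both contain
  \<open>\<sigma>\<close>; if they coincided, that face would contain \<open>{x, y}\<close>, which
  would then be a face itself.\<close>

lemma no_collapse_if_links_not_complete:
  assumes K: "abstract_complex K" "{} \<in> K"
    and lk: "\<And>\<sigma>. \<lbrakk>\<sigma> \<in> K; card \<sigma> \<le> d\<rbrakk> \<Longrightarrow> \<exists>x y. insert x \<sigma> \<in> K \<and> insert y \<sigma> \<in> K \<and> {x, y} \<notin> K"
  shows "\<not> collapsible d K"
proof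
  assume "collapsible d K"
  then obtain K' where "elementary_collapse d K K'"
    unfolding collapsible_def using K(2) by (metis converse_rtranclpE empty_iff)
  then obtain \<sigma> where \<sigma>: "\<sigma> \<in> K" "int (card \<sigma>) - 1 \<le> int d - 1"
      and ex1: "\<exists>!\<tau>. maximal_face K \<tau> \<and> \<sigma> \<subseteq> \<tau>"
    unfolding elementary_collapse_def face_dim_def by blast
  have ext: "\<exists>\<tau>. maximal_face K \<tau> \<and> \<rho> \<subseteq> \<tau>" if "\<rho> \<in> K" for \<rho>
    using finite_has_maximal2[of K \<rho>] that K(1)
    unfolding abstract_complex_def maximal_face_def by metis
  obtain x y where xy: "insert x \<sigma> \<in> K" "insert y \<sigma> \<in> K" "{x, y} \<notin> K"
    using lk[of \<sigma>] \<sigma> by auto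
  obtain \<tau> \<tau>' where "maximal_face K \<tau>" "insert x \<sigma> \<subseteq> \<tau>" "maximal_face K \<tau>'" "insert y \<sigma> \<subseteq> \<tau>'"
    using ext xy by metis
  with ex1 have "\<tau> \<in> K" "{x, y} \<subseteq> \<tau>"
    unfolding maximal_face_def by auto
  with xy(3) K(1) show False
    unfolding abstract_complex_def by blast
qed

section \<open>The suspended cover\<close>

definition cylinder :: "nat \<Rightarrow> complex set \<Rightarrow> (nat \<Rightarrow> real) set" where
  "cylinder d U = {x. (\<forall>i\<ge>d. x i = 0) \<and> Complex (x 0) (x 1) \<in> U}"

definition slab :: "nat \<Rightarrow> nat \<Rightarrow> real set \<Rightarrow> (nat \<Rightarrow> real) set" where
  "slab d j I = {x. (\<forall>i\<ge>d. x i = 0) \<and> x j \<in> I}"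

text \<open>With these, \<open>slab\<close> yields open half-spaces. Neither half-line contains 0,
  so setting a coordinate to 0 leaves both of its half-spaces.\<close>

definition halflines :: "real set set" where
  "halflines = {{..<0}, {0<..}}"

definition suspended_cover :: "nat \<Rightarrow> complex set set \<Rightarrow> (nat \<Rightarrow> real) set set" where
  "suspended_cover d P = cylinder d ` P \<union> (\<Union>j\<in>{2..<d}. slab d j ` halflines)"

lemma good_cover_suspended_cover:
  assumes d: "d \<ge> 2" and P: "\<And>Q. Q \<subseteq> P \<Longrightarrow> open (\<Inter>Q) \<and> simply_connected (\<Inter>Q)" and ne: "{} \<notin> P"
  shows "good_cover d (suspended_cover d P)"
proof -
  have cap: "topspace (Euclidean_space d) \<inter> \<Inter>\<G> = {} \<or> cell d (topspace (Euclidean_space d) \<inter> \<Inter>\<G>)"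
    if \<G>: "\<G> \<subseteq> suspended_cover d P" for \<G>
  proof -
    \<comment> \<open>Conditions on the plane and on each further coordinate are collected
      separately. Where there are none, the empty intersection is \<open>UNIV\<close>, as it should
      be.\<close>
    let ?U = "\<Inter>{U \<in> P. cylinder d U \<in> \<G>}"
    let ?I = "\<lambda>j. \<Inter>{I \<in> halflines. slab d j I \<in> \<G>}"
    have eq: "topspace (Euclidean_space d) \<inter> \<Inter>\<G> = prism d ?U ?I"
    proof (intro equalityI subsetI)
      fix x assume x: "x \<in> topspace (Euclidean_space d) \<inter> \<Inter>\<G>"
      then have mem: "x \<in> W" if "W \<in> \<G>" for W
        using that by blast
      have "Complex (x 0) (x 1) \<in> U" if "cylinder d U \<in> \<G>" for U
        using mem[OF that] by (simp add: cylinder_def)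
      moreover have "x j \<in> I" if "slab d j I \<in> \<G>" for j I
        using mem[OF that] by (simp add: slab_def)
      ultimately show "x \<in> prism d ?U ?I"
        using x by (simp add: prism_def topspace_Euclidean_space)
    next
      fix x assume x: "x \<in> prism d ?U ?I"
      have "x \<in> W" if W: "W \<in> \<G>" for W
      proof -
        have "W \<in> cylinder d ` P \<union> (\<Union>j\<in>{2..<d}. slab d j ` halflines)"
          using \<G> W unfolding suspended_cover_def by blast
        then consider U where "U \<in> P" "W = cylinder d U"
          | j I where "j \<in> {2..<d}" "I \<in> halflines" "W = slab d j I"
          by blast
        then show ?thesis
          using x W by cases (simp_all add: prism_def cylinder_def slab_def)
      qed
      then show "x \<in> topspace (Euclidean_space d) \<inter> \<Inter>\<G>"
        using x by (auto simp: prism_def topspace_Euclidean_space)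
    qed
    have "?I j \<in> {UNIV, {}, {..<0}, {0<..}}" for j
    proof -
      define S where "S = {I \<in> halflines. slab d j I \<in> \<G>}"
      have "S = {} \<or> S = {{..<0}} \<or> S = {{0<..}} \<or> S = {{..<0}, {0<..}}"
        unfolding S_def halflines_def by blast
      moreover have "{..<0::real} \<inter> {0<..} = {}" by auto
      ultimately have "\<Inter>S \<in> {UNIV, {}, {..<0}, {0<..}}"
        by (elim disjE) simp_all
      then show ?thesis by (simp only: S_def)
    qed
    then show ?thesis
      unfolding eq using cell_prism[OF d, of ?U ?I] P[of "{U \<in> P. cylinder d U \<in> \<G>}"] by blast
  qed
  \<comment> \<open>A single member is the intersection of a one-element subfamily, so it remains
    only to exhibit a point in it.\<close>
  have "cell d W" if W: "W \<in> suspended_cover d P" for W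
  proof -
    have sub: "W \<subseteq> topspace (Euclidean_space d)"
      using W by (auto simp: suspended_cover_def cylinder_def slab_def topspace_Euclidean_space)
    have "W \<noteq> {}"
    proof (cases "W \<in> cylinder d ` P")
      case True
      then obtain U z where "W = cylinder d U" "z \<in> U"
        using ne by (metis equals0I imageE)
      then have "(\<lambda>i. if i = 0 then Re z else if i = 1 then Im z else 0) \<in> W"
        using d by (auto simp: cylinder_def)
      then show ?thesis by blast
    next
      case False
      then obtain j I where j: "j \<in> {2..<d}" "I \<in> halflines" "W = slab d j I"
        using W by (auto simp: suspended_cover_def)
      moreover obtain t where "t \<in> I"
        using j(2) by (metis halflines_def insertE singletonD greaterThan_iff lessThan_iff less_numeral_extra(1) neg_less_0_iff_less)
      ultimately have "(\<lambda>i. if i = j then t else 0) \<in> W"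
        by (auto simp: slab_def)
      then show ?thesis by blast
    qed
    then show ?thesis
      using cap[of "{W}"] W sub by (simp add: Int_absorb1)
  qed
  then show ?thesis
    using cap by (auto simp: good_cover_def)
qed

text \<open>Either some coordinate has no half-space in \<open>\<sigma>\<close>, and its two
  half-spaces extend \<open>\<sigma>\<close>; or \<open>\<sigma>\<close> has at least
  \<open>d - 2\<close> half-spaces, which leaves at most two cylinders, and the planar hypothesis
  applies to their bases.\<close>

lemma suspended_cover_link:
  assumes d: "d \<ge> 2" and "P \<noteq> {}" "{} \<notin> P"
    and P: "\<And>U V. \<lbrakk>U \<in> P; V \<in> P; U \<inter> V \<noteq> {}\<rbrakk> \<Longrightarrow>
      \<exists>X\<in>P. \<exists>Y\<in>P. U \<inter> V \<inter> X \<noteq> {} \<and> U \<inter> V \<inter> Y \<noteq> {} \<and> X \<inter> Y = {}"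
    and \<sigma>: "\<sigma> \<subseteq> suspended_cover d P" "finite \<sigma>" "card \<sigma> \<le> d" "\<Inter>\<sigma> \<noteq> {}"
  shows "\<exists>X\<in>suspended_cover d P. \<exists>Y\<in>suspended_cover d P. X \<inter> \<Inter>\<sigma> \<noteq> {} \<and> Y \<inter> \<Inter>\<sigma> \<noteq> {} \<and> X \<inter> Y = {}"
proof -
  obtain a where a: "a \<in> \<Inter>\<sigma>" using \<sigma>(4) by blast
  \<comment> \<open>For empty \<open>\<sigma>\<close> the intersection is the whole function type,
    so \<open>a\<close> need not lie in \<open>R^d\<close>; truncation repairs this and changes
    nothing otherwise.\<close>
  define a' where "a' = (\<lambda>i. if i < d then a i else 0)"
  have a': "a' \<in> W" if "W \<in> \<sigma>" for W
  proof -
    have "a' = a" if "\<forall>i\<ge>d. a i = 0"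
      using that by (auto simp: a'_def)
    moreover have "a \<in> W" "W \<in> suspended_cover d P" using a \<sigma> that by auto
    ultimately show ?thesis
      by (auto simp: suspended_cover_def cylinder_def slab_def)
  qed
  show ?thesis
  proof (cases "\<exists>j\<in>{2..<d}. \<forall>I\<in>halflines. slab d j I \<notin> \<sigma>")
    case True
    then obtain j where j: "j \<in> {2..<d}" "\<And>I. I \<in> halflines \<Longrightarrow> slab d j I \<notin> \<sigma>" by blast
    \<comment> \<open>No member of \<open>\<sigma>\<close> restricts coordinate \<open>j\<close>:
      cylinders see only coordinates 0 and 1, and every half-space in \<open>\<sigma>\<close>
      belongs to another coordinate.\<close>
    have upd: "a'(j := t) \<in> \<Inter>\<sigma>" for t
    proof
      fix W assume W: "W \<in> \<sigma>"
      with \<sigma>(1) consider U where "W = cylinder d U" | k I where "I \<in> halflines" "k \<in> {2..<d}" "W = slab d k I"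
        by (auto simp: suspended_cover_def)
      then show "a'(j := t) \<in> W"
      proof cases
        case 1
        then show ?thesis using a'[OF W] j by (auto simp: cylinder_def)
      next
        case 2
        then have "k \<noteq> j" using j W by blast
        then show ?thesis using 2 a'[OF W] j by (auto simp: slab_def)
      qed
    qed
    have "a'(j := - 1) \<in> slab d j {..<0}" "a'(j := 1) \<in> slab d j {0<..}"
      using j by (auto simp: slab_def a'_def)
    moreover have "slab d j {..<0} \<in> suspended_cover d P" "slab d j {0<..} \<in> suspended_cover d P"
      using j by (auto simp: suspended_cover_def halflines_def)
    moreover have "slab d j {..<0} \<inter> slab d j {0<..} = {}"
      by (auto simp: slab_def)
    ultimately show ?thesis using upd by blast
  next
    case False
    then obtain I where I: "\<And>j. j \<in> {2..<d} \<Longrightarrow> I j \<in> halflines \<and> slab d j (I j) \<in> \<sigma>"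
      by metis
    \<comment> \<open>A test for being different from the chosen half-space of coordinate
      \<open>j\<close>. Cylinders and half-spaces of other coordinates pass it, since they ignore
      coordinate \<open>j\<close>; this gives the count of \<open>T\<close> and its disjointness
      from \<open>S\<close>.\<close>
    have slab_ne: "slab d j (I j) \<noteq> W"
      if j: "j \<in> {2..<d}" and W: "a'(j := 0) \<in> W" for j W
      using I[OF j] W by (auto simp: slab_def halflines_def)
    define T where "T = (\<lambda>j. slab d j (I j)) ` {2..<d}"
    define S where "S = \<sigma> \<inter> cylinder d ` P"
    have "inj_on (\<lambda>j. slab d j (I j)) {2..<d}"
    proof (rule inj_onI, rule ccontr)
      fix j k assume jk: "j \<in> {2..<d}" "k \<in> {2..<d}" "slab d j (I j) = slab d k (I k)" "j \<noteq> k"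
      have "a' \<in> slab d k (I k)"
        using I jk a' by blast
      then have "a'(j := 0) \<in> slab d k (I k)"
        using jk by (auto simp: slab_def)
      then show False
        using slab_ne jk by blast
    qed
    then have "card T = d - 2"
      by (simp add: T_def card_image)
    moreover have "T \<inter> S = {}"
    proof -
      have "slab d j (I j) \<noteq> W" if "j \<in> {2..<d}" "W \<in> S" for j W
      proof (rule slab_ne)
        have "a' \<in> W" using that a' by (auto simp: S_def)
        then show "a'(j := 0) \<in> W"
          using that by (auto simp: S_def cylinder_def)
      qed (use that in auto)
      then show ?thesis unfolding T_def by blast
    qed
    moreover have "T \<union> S \<subseteq> \<sigma>"
      using I by (auto simp: T_def S_def)
    moreover have "finite T" "finite S"
      using \<sigma>(2) by (auto simp: T_def S_def)
    ultimately have "d - 2 + card S \<le> card \<sigma>"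
      by (metis card_Un_disjoint card_mono \<sigma>(2))
    then have "card S \<le> 2"
      using \<sigma>(3) d by linarith
    moreover have S: "\<exists>U\<in>P. W = cylinder d U \<and> Complex (a' 0) (a' 1) \<in> U" if "W \<in> S" for W
      using that a' by (auto simp: S_def cylinder_def)
    \<comment> \<open>With fewer than two cylinders, take \<open>U = V\<close>, for empty
      \<open>S\<close> an arbitrary member of \<open>P\<close>. Otherwise the first two coordinates
      of \<open>a'\<close> give a common point.\<close>
    ultimately obtain U V where UV: "U \<in> P" "V \<in> P" "U \<inter> V \<noteq> {}" "S \<subseteq> {cylinder d U, cylinder d V}"
    proof -
      consider "S = {}" | W where "S = {W}" | W W' where "S = {W, W'}"
        using \<open>card S \<le> 2\<close> \<open>finite S\<close>
        by (metis One_nat_def Suc_1 card_0_eq card_1_singletonE card_2_iff le_Suc_eq le_zero_eq)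
      then show thesis
      proof cases
        case 1
        obtain U where "U \<in> P" "U \<noteq> {}" using \<open>P \<noteq> {}\<close> \<open>{} \<notin> P\<close> by auto
        then show thesis using that[of U U] 1 by simp
      next
        case 2
        with S obtain U where "U \<in> P" "W = cylinder d U" "Complex (a' 0) (a' 1) \<in> U" by blast
        then show thesis using that[of U U] 2 by blast
      next
        case 3
        with S obtain U V where "U \<in> P" "W = cylinder d U" "Complex (a' 0) (a' 1) \<in> U"
            "V \<in> P" "W' = cylinder d V" "Complex (a' 0) (a' 1) \<in> V"
          by (meson insertI1 insertI2)
        then show thesis using that[of U V] 3 by blast
      qed
    qed
    obtain X Y where XY: "X \<in> P" "Y \<in> P" "U \<inter> V \<inter> X \<noteq> {}" "U \<inter> V \<inter> Y \<noteq> {}" "X \<inter> Y = {}"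
      using P[OF UV(1-3)] by blast
    have ex: "cylinder d Z \<inter> \<Inter>\<sigma> \<noteq> {}" if Z: "U \<inter> V \<inter> Z \<noteq> {}" for Z
    proof -
      obtain z where z: "z \<in> U" "z \<in> V" "z \<in> Z" using Z by blast
      \<comment> \<open>Moving \<open>a'\<close> in the planar coordinates alone keeps it in all
        half-spaces of \<open>\<sigma>\<close>, as these concern coordinates from 2 on.\<close>
      let ?b = "a'(0 := Re z, 1 := Im z)"
      have b: "?b \<in> cylinder d Q" if "z \<in> Q" for Q
        using d that by (auto simp: cylinder_def a'_def)
      have "?b \<in> W" if W: "W \<in> \<sigma>" for W
      proof (cases "W \<in> S")
        case True
        then show ?thesis using b z UV(4) by blast
      next
        case False
        then obtain j J where "j \<in> {2..<d}" "W = slab d j J"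
          using \<sigma>(1) W by (auto simp: suspended_cover_def S_def)
        then show ?thesis
          using a'[OF W] d by (auto simp: slab_def)
      qed
      with b[OF z(3)] show ?thesis by blast
    qed
    have "cylinder d X \<inter> cylinder d Y = {}"
      using XY(5) by (auto simp: cylinder_def)
    moreover have "cylinder d X \<in> suspended_cover d P" "cylinder d Y \<in> suspended_cover d P"
      using XY(1,2) by (auto simp: suspended_cover_def)
    ultimately show ?thesis
      using ex[OF XY(3)] ex[OF XY(4)] by blast
  qed
qed

section \<open>Assembling the counterexample\<close>

lemma counterexample_from_planar_family:
  fixes P :: "complex set set"
  assumes d: "d \<ge> 2" and P: "finite P" "P \<noteq> {}" "{} \<notin> P"
    and sc: "\<And>Q. Q \<subseteq> P \<Longrightarrow> open (\<Inter>Q) \<and> simply_connected (\<Inter>Q)"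
    and lk: "\<And>U V. \<lbrakk>U \<in> P; V \<in> P; U \<inter> V \<noteq> {}\<rbrakk> \<Longrightarrow>
      \<exists>X\<in>P. \<exists>Y\<in>P. U \<inter> V \<inter> X \<noteq> {} \<and> U \<inter> V \<inter> Y \<noteq> {} \<and> X \<inter> Y = {}"
  shows "\<exists>K :: nat set set. abstract_complex K \<and> topologically_representable d K \<and> \<not> collapsible d K"
proof -
  let ?G = "suspended_cover d P"
  have fin: "finite ?G"
    using P(1) by (auto simp: suspended_cover_def halflines_def)
  then obtain g :: "(nat \<Rightarrow> real) set \<Rightarrow> nat" where g: "inj_on g ?G"
    using finite_imp_inj_to_nat_seg by blast
  \<comment> \<open>The nerve with its vertices renamed to natural numbers; injectivity of
    \<open>g\<close> lets faces be recovered from their images.\<close>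
  define K where "K = (`) g ` nerve ?G"
  have good: "good_cover d ?G"
    using d sc P(3) by (rule good_cover_suspended_cover)
  have inK: "g ` \<sigma> \<in> K \<longleftrightarrow> \<sigma> \<in> nerve ?G" if "\<sigma> \<subseteq> ?G" for \<sigma>
  proof
    assume "g ` \<sigma> \<in> K"
    then obtain \<tau> where "\<tau> \<in> nerve ?G" "g ` \<sigma> = g ` \<tau>"
      by (auto simp: K_def)
    then show "\<sigma> \<in> nerve ?G"
      using inj_on_image_eq_iff[OF g that, of \<tau>] by (auto simp: nerve_def)
  qed (simp add: K_def)
  have sub: "\<exists>\<sigma>'\<subseteq>?G. \<rho> = g ` \<sigma>' \<and> \<sigma>' \<in> nerve ?G" if "\<rho> \<in> K" for \<rho>
    using that by (auto simp: K_def nerve_def)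
  have cplx: "abstract_complex K"
    unfolding abstract_complex_def
  proof (intro conjI ballI allI impI)
    have "nerve ?G \<subseteq> Pow ?G" by (auto simp: nerve_def)
    then show "finite K"
      unfolding K_def using fin by (metis finite_Pow_iff finite_imageI finite_subset)
    show "finite \<sigma>" if "\<sigma> \<in> K" for \<sigma>
      using sub[OF that] fin finite_subset by blast
    show "\<tau> \<in> K" if "\<sigma> \<in> K" "\<tau> \<subseteq> \<sigma>" for \<sigma> \<tau>
    proof -
      obtain \<sigma>' where \<sigma>': "\<sigma> = g ` \<sigma>'" "\<sigma>' \<in> nerve ?G"
        using sub[OF \<open>\<sigma> \<in> K\<close>] by blast
      then obtain \<tau>' where "\<tau>' \<subseteq> \<sigma>'" "\<tau> = g ` \<tau>'"
        using \<open>\<tau> \<subseteq> \<sigma>\<close> by (metis subset_imageE)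
      moreover from this have "\<tau>' \<in> nerve ?G"
        using \<sigma>'(2) unfolding nerve_def by blast
      ultimately show ?thesis by (simp add: K_def)
    qed
  qed
  \<comment> \<open>Only nonempty sets are vertices of the nerve. Every cell is nonempty, because it
    is homeomorphic to a ball, which contains the origin.\<close>
  have vert: "\<Union>(nerve ?G) = ?G"
  proof -
    have "W \<noteq> {}" if "W \<in> ?G" for W
    proof -
      have "cell d W" using good that by (simp add: good_cover_def)
      moreover have "(\<lambda>i. 0) \<in> unit_open_ball d"
        by (simp add: unit_open_ball_def topspace_Euclidean_space)
      ultimately show ?thesis
        unfolding cell_def homeomorphic_space_def homeomorphic_maps_def continuous_map_def
        by (auto simp: unit_open_ball_def)
    qed
    then have "{W} \<in> nerve ?G" if "W \<in> ?G" for W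
      using that by (simp add: nerve_def)
    then have "?G \<subseteq> \<Union>(nerve ?G)"
      by blast
    moreover have "\<Union>(nerve ?G) \<subseteq> ?G"
      unfolding nerve_def by blast
    ultimately show ?thesis
      by (rule equalityI[rotated])
  qed
  have "complex_isomorphic K (nerve ?G)"
    unfolding complex_isomorphic_def
  proof (intro exI conjI allI impI)
    have UK: "\<Union>K = g ` ?G"
      unfolding K_def image_Union[symmetric] vert ..
    show bij: "bij_betw (inv_into ?G g) (\<Union>K) (\<Union>(nerve ?G))"
      unfolding vert UK using g by (simp add: bij_betw_inv_into inj_on_imp_bij_betw)
    fix \<sigma> assume \<sigma>: "\<sigma> \<subseteq> \<Union>K"
    have "inv_into ?G g ` \<sigma> \<subseteq> ?G"
      using \<sigma> UK by (auto intro: inv_into_into)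
    moreover have "g ` inv_into ?G g ` \<sigma> = \<sigma>"
      using \<sigma> UK by (simp add: image_inv_into_cancel)
    ultimately show "\<sigma> \<in> K \<longleftrightarrow> inv_into ?G g ` \<sigma> \<in> nerve ?G"
      using inK by metis
  qed
  then have rep: "topologically_representable d K"
    using fin good unfolding topologically_representable_def by blast
  have "\<not> collapsible d K"
  proof (rule no_collapse_if_links_not_complete[OF cplx])
    show "{} \<in> K"
      using inK[of "{}"] by (simp add: nerve_def)
    fix \<sigma> assume "\<sigma> \<in> K" "card \<sigma> \<le> d"
    obtain \<sigma>' where \<sigma>': "\<sigma>' \<subseteq> ?G" "\<sigma> = g ` \<sigma>'" "\<sigma>' \<in> nerve ?G"
      using sub[OF \<open>\<sigma> \<in> K\<close>] by blast
    then have "\<Inter>\<sigma>' \<noteq> {}"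
      by (simp add: nerve_def)
    moreover have "card \<sigma>' \<le> d"
      using \<open>card \<sigma> \<le> d\<close> \<sigma>'(2) card_image[OF inj_on_subset[OF g \<sigma>'(1)]] by simp
    ultimately obtain X Y where XY: "X \<in> ?G" "Y \<in> ?G" "X \<inter> \<Inter>\<sigma>' \<noteq> {}" "Y \<inter> \<Inter>\<sigma>' \<noteq> {}" "X \<inter> Y = {}"
      using suspended_cover_link[OF d P(2,3) lk \<sigma>'(1) finite_subset[OF \<sigma>'(1) fin]] by blast
    have "g ` insert X \<sigma>' \<in> K" "g ` insert Y \<sigma>' \<in> K"
      using \<sigma>'(1) XY(1-4) by (subst inK; simp add: nerve_def)+
    moreover have "g ` {X, Y} \<notin> K"
      using XY(1,2,5) by (subst inK) (simp_all add: nerve_def)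
    ultimately show "\<exists>x y. insert x \<sigma> \<in> K \<and> insert y \<sigma> \<in> K \<and> {x, y} \<notin> K"
      unfolding \<sigma>'(2) image_insert image_empty by blast
  qed
  with cplx rep show ?thesis by blast
qed

theorem theorem1p2:
  fixes d :: nat
  assumes "d \<ge> 2"
  shows "\<exists>K :: nat set set.
    abstract_complex K \<and> topologically_representable d K \<and> \<not> collapsible d K"
  using assms planar_family_nonempty planar_family_Inter planar_family_link
  by (rule counterexample_from_planar_family)

end
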